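(* Let $\{X_i:i=0,1,\ldots\}$ be a time-homogeneous discrete-time Markov chain with deterministic initial state $X_0=x^\star$, where $x^\star$ is a transient state. For each integer $n\ge 1$ let $N_n=|\{1\le i\le n: X_i=x^\star\}|$. Let $q=\lim_{n\to\infty}\mathbb{P}(N_n=0)$, which is strictly positive by transience of $x^\star$, and let $H\sim\mathrm{Geom}(q)$. Then, for every $n\ge 1$, $$d_{\mathrm{TV}}(N_n,H)\le q\left\lceil\frac{1-q}{q}\right\rceil\sum_{i=n+1}^\infty\mathbb{P}(X_i=x^\star),$$ where $\lceil\cdot\rceil$ is the ceiling function.
   Context: Let $\mathbb{Z}^+=\{0,1,2,\ldots\}$. For random variables $N$ and $G$ taking values in $\mathbb{Z}^+$, the total variation distance is $d_{\mathrm{TV}}(N,G)=\sup_{A\subseteq\mathbb{Z}^+}|\mathbb{P}(N\in A)-\mathbb{P}(G\in A)|$. For $p\in(0,1]$, $G\sim\mathrm{Geom}(p)$ means $\mathbb{P}(G=j)=p(1-p)^j$ for $j\in\mathbb{Z}^+$ (with $0^0=1$). The state $x^\star$ is transient if, starting from $x^\star$, the probability that the chain ever returns to $x^\star$ (at some time $i\ge 1$) is strictly less than $1$. *)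

theory Defs
  imports "HOL-Probability.Probability"
begin

text \<open>
  The state space is an arbitrary measurable space S; a countable state space is the
  case where S is a count space. The conditional expectation is taken with respect to
  the sigma-algebra generated by the whole history X 0, ..., X i, and
  the one-step transition kernel K does not depend on i (time homogeneity).
\<close>

locale markov_chain = prob_space M
  for M :: "'w measure" +
  fixes S :: "'s measure"
    and K :: "'s \<Rightarrow> 's measure"
    and X :: "nat \<Rightarrow> 'w \<Rightarrow> 's"
  assumes measurable_X: "\<And>i. X i \<in> measurable M S"
    and measurable_K: "K \<in> measurable S (prob_algebra S)"
    and markov: "\<And>i B. B \<in> sets S \<Longrightarrow>
      AE \<omega> in M.
        real_cond_exp M
          (vimage_algebra (space M) (\<lambda>\<omega>. \<lambda>j\<in>{..i}. X j \<omega>) (\<Pi>\<^sub>M j\<in>{..i}. S))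
          (indicator {\<omega> \<in> space M. X (Suc i) \<omega> \<in> B}) \<omega>
        = measure (K (X i \<omega>)) B"

definition visits :: "(nat \<Rightarrow> 'w \<Rightarrow> 's) \<Rightarrow> 's \<Rightarrow> nat \<Rightarrow> 'w \<Rightarrow> nat" where
  "visits X x n \<omega> = card {i \<in> {1..n}. X i \<omega> = x}"

definition tv_dist :: "'a measure \<Rightarrow> ('a \<Rightarrow> nat) \<Rightarrow> 'b measure \<Rightarrow> ('b \<Rightarrow> nat) \<Rightarrow> real" where
  "tv_dist M N M' G =
     (SUP A. \<bar>measure M {\<omega> \<in> space M. N \<omega> \<in> A} - measure M' {\<omega> \<in> space M'. G \<omega> \<in> A}\<bar>)"

text \<open>
  For a chain started at x this is the return probability of x, so that x is
  transient iff it is less than 1.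
\<close>

definition return_prob :: "'w measure \<Rightarrow> (nat \<Rightarrow> 'w \<Rightarrow> 's) \<Rightarrow> 's \<Rightarrow> real" where
  "return_prob M X x = measure M {\<omega> \<in> space M. \<exists>i\<ge>1. X i \<omega> = x}"

end

theory Submission
  imports Defs
begin

text \<open>
  The proof is a last-exit decomposition followed by a coupling. Let \<open>\<rho>\<close> be the probability that the
  chain started at \<open>x\<close> never comes back (\<open>escape\<close> below); by continuity of measure it is the limit
  \<open>q\<close>, and it is positive because \<open>x\<close> is transient. The Markov property enters only through
  \<open>no_return_after\<close>: if \<open>A\<close> is an event of the history up to time \<open>i\<close> on which \<open>X i = x\<close>, then the
  probability of \<open>A\<close> together with no visit after time \<open>i\<close> is \<open>\<rho> P(A)\<close>.

  Take \<open>A = {X i = x}\<close>. The resulting events, on which \<open>i\<close> is the time of the last visit, are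
  disjoint in \<open>i\<close>, so \<open>\<Sum>i. \<rho> P(X i = x) \<le> 1\<close>. Hence the sum of \<open>P(X i = x)\<close> converges and, by
  Borel-Cantelli, almost surely there is a last visit. Summing over its time \<open>i > n\<close> gives
  \<open>P(some visit after n) = \<rho> (\<Sum>i>n. P(X i = x))\<close> (\<open>prob_visit_after\<close>).

  Take \<open>A = {X i = x, i is the time of the k-th visit}\<close>. Summing over \<open>i\<close> says that the total number
  of visits \<open>N\<close> satisfies \<open>P(N = k) = \<rho> P(N \<ge> k)\<close>, which forces \<open>N\<close> to be geometric with
  parameter \<open>\<rho>\<close> (\<open>distr_total_visits\<close>).

  So \<open>H\<close> has the law of \<open>N\<close>, and the number of visits up to time \<open>n\<close> differs from \<open>N\<close> only if there
  is a visit after time \<open>n\<close>. The total variation distance is therefore at most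
  \<open>\<rho> (\<Sum>i>n. P(X i = x))\<close>. The ceiling in the statement is at least \<open>1\<close> when \<open>\<rho> < 1\<close>; when \<open>\<rho> = 1\<close>
  the state is almost surely never revisited and both sides are \<open>0\<close>.
\<close>

section \<open>The Markov property at a deterministic time\<close>

context markov_chain
begin

definition past :: "nat \<Rightarrow> 'w measure" where
  "past i = vimage_algebra (space M) (\<lambda>\<omega>. \<lambda>j\<in>{..i}. X j \<omega>) (\<Pi>\<^sub>M j\<in>{..i}. S)"

lemma space_past [simp]: "space (past i) = space M"
  by (simp add: past_def)

lemma measurable_X_past:
  assumes "j \<le> i"
  shows "X j \<in> measurable (past i) S"
proof -
  have "(\<lambda>\<omega>. \<lambda>j\<in>{..i}. X j \<omega>) \<in> measurable (past i) (\<Pi>\<^sub>M j\<in>{..i}. S)"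
    unfolding past_def
    by (rule measurable_vimage_algebra1)
       (auto simp: space_PiM measurable_space[OF measurable_X] split: if_splits)
  from measurable_compose[OF this measurable_component_singleton[of j]] assms
  show ?thesis by simp
qed

lemma sets_past_subset:
  assumes "space N = space M" "\<And>j. j \<le> i \<Longrightarrow> X j \<in> measurable N S"
  shows "sets (past i) \<subseteq> sets N"
  unfolding past_def
  by (rule sets_image_in_sets[OF assms(1)]) (auto intro!: measurable_restrict assms(2))

lemma sets_past_mono: "i \<le> k \<Longrightarrow> sets (past i) \<subseteq> sets (past k)"
  by (intro sets_past_subset measurable_X_past) auto

lemma subalgebra_past: "subalgebra M (past i)"
  unfolding subalgebra_def using sets_past_subset[of M i] measurable_X by auto

lemma sets_past_sets: "A \<in> sets (past i) \<Longrightarrow> A \<in> sets M"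
  using subalgebra_past by (auto simp: subalgebra_def)

text \<open>
  The defining property of the conditional expectation, integrated over an event of the past. The
  transition is stated with nonnegative integrals because these fit the monadic bind below.
\<close>

lemma one_step_events:
  assumes A: "A \<in> sets (past i)" and B: "B \<in> sets S"
  shows "emeasure M {\<omega> \<in> A. X (Suc i) \<omega> \<in> B} = (\<integral>\<^sup>+\<omega>\<in>A. emeasure (K (X i \<omega>)) B \<partial>M)"
proof -
  interpret finite_measure_subalgebra M "past i"
    by unfold_locales (rule subalgebra_past)
  note [measurable] = measurable_X measurable_prob_algebraD[OF measurable_K] B sets_past_sets[OF A]
  have Asub: "A \<subseteq> space M" using sets.sets_into_space[OF sets_past_sets[OF A]] .
  let ?E = "{\<omega> \<in> space M. X (Suc i) \<omega> \<in> B}"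
  have Emeas: "?E \<in> sets M" by measurable
  have Kp: "prob_space (K (X i \<omega>))" if "\<omega> \<in> space M" for \<omega>
    using measurable_space[OF measurable_K measurable_space[OF measurable_X that]]
    by (simp add: space_prob_algebra)
  have m: "(\<lambda>\<omega>. measure (K (X i \<omega>)) B) \<in> borel_measurable M" by measurable
  have int: "integrable M (\<lambda>\<omega>. indicator A \<omega> * measure (K (X i \<omega>)) B)"
    by (rule integrable_const_bound[where B=1])
       (use m in \<open>auto simp: indicator_def prob_space.prob_le_1[OF Kp]\<close>)
  have "measure M {\<omega> \<in> A. X (Suc i) \<omega> \<in> B} = set_lebesgue_integral M A (indicator ?E)"
  proof -
    have "set_lebesgue_integral M A (indicator ?E) = integral\<^sup>L M (indicator {\<omega> \<in> A. X (Suc i) \<omega> \<in> B} :: _ \<Rightarrow> real)"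
      unfolding set_lebesgue_integral_def using Asub
      by (intro Bochner_Integration.integral_cong) (auto simp: indicator_def)
    moreover have "{\<omega> \<in> A. X (Suc i) \<omega> \<in> B} = A \<inter> ?E" using Asub by auto
    ultimately show ?thesis using Asub Emeas by (simp add: Int_absorb1 Int_absorb2 Int_assoc)
  qed
  also have "\<dots> = (\<integral>\<omega>\<in>A. real_cond_exp M (past i) (indicator ?E) \<omega> \<partial>M)"
    by (rule real_cond_exp_intA[OF _ A])
       (use Emeas in \<open>simp add: less_top[symmetric]\<close>)
  also have "\<dots> = (\<integral>\<omega>\<in>A. measure (K (X i \<omega>)) B \<partial>M)"
    unfolding set_lebesgue_integral_def
  proof (rule integral_cong_AE)
    show "AE \<omega> in M. indicator A \<omega> *\<^sub>R real_cond_exp M (past i) (indicator ?E) \<omega>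
        = indicator A \<omega> *\<^sub>R measure (K (X i \<omega>)) B"
      using markov[OF B, of i] unfolding past_def by auto
  qed (use m in measurable)
  finally have "emeasure M {\<omega> \<in> A. X (Suc i) \<omega> \<in> B}
      = ennreal (\<integral>\<omega>. indicator A \<omega> * measure (K (X i \<omega>)) B \<partial>M)"
    by (simp add: emeasure_eq_measure set_lebesgue_integral_def)
  also have "\<dots> = (\<integral>\<^sup>+\<omega>. ennreal (indicator A \<omega> * measure (K (X i \<omega>)) B) \<partial>M)"
    by (rule nn_integral_eq_integral[symmetric, OF int]) (simp add: indicator_def)
  also have "\<dots> = (\<integral>\<^sup>+\<omega>\<in>A. emeasure (K (X i \<omega>)) B \<partial>M)"
    by (intro nn_integral_cong)
       (auto simp: indicator_def finite_measure.emeasure_eq_measure[OF prob_space.axioms(1)[OF Kp]])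
  finally show ?thesis .
qed

text \<open>
  For fixed \<open>A\<close>, \<open>one_step_events\<close> says that the law of \<open>X (Suc i)\<close> restricted to \<open>A\<close> is the law of
  \<open>X i\<close> restricted to \<open>A\<close>, pushed through the kernel. Two equal measures integrate every nonnegative
  function alike, which extends the Markov property from events to functions.
\<close>

lemma one_step:
  assumes A: "A \<in> sets (past i)" and f: "f \<in> borel_measurable S"
  shows "(\<integral>\<^sup>+\<omega>\<in>A. f (X (Suc i) \<omega>) \<partial>M) = (\<integral>\<^sup>+\<omega>\<in>A. (\<integral>\<^sup>+s. f s \<partial>K (X i \<omega>)) \<partial>M)"
proof -
  note K = measurable_prob_algebraD[OF measurable_K]
  note [measurable] = measurable_X K f sets_past_sets[OF A]
  define \<mu> where "\<mu> = density M (indicator A)"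
  have [measurable_cong]: "sets \<mu> = sets M" and sp: "space \<mu> = space M"
    by (simp_all add: \<mu>_def)
  have Asub: "A \<subseteq> space M" using sets.sets_into_space[OF sets_past_sets[OF A]] .
  have Kd: "K \<in> measurable (distr \<mu> S (X i)) (subprob_algebra S)" by measurable
  have ne: "space (distr \<mu> S (X i)) \<noteq> {}"
    using measurable_space[OF measurable_X[of i]] not_empty by auto
  have "distr \<mu> S (X (Suc i)) = distr \<mu> S (X i) \<bind> K"
  proof (rule measure_eqI)
    show "sets (distr \<mu> S (X (Suc i))) = sets (distr \<mu> S (X i) \<bind> K)"
      using sets_bind[OF sets_kernel[OF Kd] ne] by simp
  next
    fix B assume "B \<in> sets (distr \<mu> S (X (Suc i)))"
    then have B [measurable]: "B \<in> sets S" by simp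
    have "emeasure (distr \<mu> S (X (Suc i))) B = emeasure M {\<omega> \<in> A. X (Suc i) \<omega> \<in> B}"
    proof -
      have "X (Suc i) -` B \<inter> space M \<in> sets M" by measurable
      moreover have "A \<inter> (X (Suc i) -` B \<inter> space M) = {\<omega> \<in> A. X (Suc i) \<omega> \<in> B}"
        using Asub by auto
      ultimately show ?thesis
        by (simp add: emeasure_distr sp) (simp add: \<mu>_def emeasure_restricted)
    qed
    also have "\<dots> = (\<integral>\<^sup>+\<omega>. emeasure (K (X i \<omega>)) B \<partial>\<mu>)"
      by (simp add: one_step_events[OF A B] \<mu>_def nn_integral_density mult.commute)
    also have "\<dots> = emeasure (distr \<mu> S (X i) \<bind> K) B"
      by (simp add: emeasure_bind[OF ne Kd B] nn_integral_distr)
    finally show "emeasure (distr \<mu> S (X (Suc i))) B = emeasure (distr \<mu> S (X i) \<bind> K) B" .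
  qed
  then have "(\<integral>\<^sup>+s. f s \<partial>distr \<mu> S (X (Suc i))) = (\<integral>\<^sup>+s. f s \<partial>(distr \<mu> S (X i) \<bind> K))" by simp
  then have "(\<integral>\<^sup>+\<omega>. f (X (Suc i) \<omega>) \<partial>\<mu>) = (\<integral>\<^sup>+\<omega>. (\<integral>\<^sup>+s. f s \<partial>K (X i \<omega>)) \<partial>\<mu>)"
    by (simp add: nn_integral_bind[OF f Kd] nn_integral_distr)
  then show ?thesis
    by (simp add: \<mu>_def nn_integral_density mult.commute)
qed

end

section \<open>Regeneration at visits of the starting state\<close>

locale chain_from = markov_chain +
  fixes x :: 'b
  assumes singleton_x: "{x} \<in> sets S"
    and start: "AE \<omega> in M. X 0 \<omega> = x"
begin

text \<open>
  \<open>avoid m s\<close> is the probability that a chain now at \<open>s\<close> misses \<open>x\<close> at each of its next \<open>m\<close> steps.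
  It is built from the kernel alone, so that it is defined pointwise and the same at every time.
\<close>

primrec avoid :: "nat \<Rightarrow> 'b \<Rightarrow> ennreal" where
  "avoid 0 s = 1"
| "avoid (Suc m) s = (\<integral>\<^sup>+s'. indicator (space S - {x}) s' * avoid m s' \<partial>K s)"

lemma measurable_avoid [measurable]: "avoid m \<in> borel_measurable S"
proof (induction m)
  case 0
  show ?case by (simp cong: measurable_cong)
next
  case (Suc m)
  note [measurable] = Suc measurable_prob_algebraD[OF measurable_K] singleton_x
  have "(\<lambda>s. \<integral>\<^sup>+s'. indicator (space S - {x}) s' * avoid m s' \<partial>K s) \<in> borel_measurable S"
    by measurable
  then show ?case by (simp cong: measurable_cong)
qed

lemma event_x_past: "j \<le> i \<Longrightarrow> {\<omega> \<in> space M. X j \<omega> = x} \<in> sets (past i)"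
  using measurable_sets[OF measurable_X_past singleton_x, of j i]
  by (simp add: vimage_def Int_def conj_commute)

lemma pred_x [measurable]: "Measurable.pred M (\<lambda>\<omega>. X j \<omega> = x)"
  using sets_past_sets[OF event_x_past[of j j]] by (simp add: pred_def)

text \<open>
  Induction on \<open>m\<close>: the condition on the first step is absorbed into the event of the past, the
  induction hypothesis is used at time \<open>Suc i\<close>, and \<open>one_step\<close> brings the integral back to time \<open>i\<close>.
\<close>

lemma avoid_for_steps:
  assumes "A \<in> sets (past i)"
  shows "emeasure M {\<omega> \<in> A. \<forall>j\<in>{i<..i+m}. X j \<omega> \<noteq> x} = (\<integral>\<^sup>+\<omega>\<in>A. avoid m (X i \<omega>) \<partial>M)"
  using assms
proof (induction m arbitrary: i A)
  case 0
  then show ?case using sets_past_sets[OF 0] by (simp cong: conj_cong)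
next
  case (Suc m)
  note [measurable] = singleton_x
  have Asub: "A \<subseteq> space M" using sets.sets_into_space[OF sets_past_sets[OF Suc.prems]] .
  define A' where "A' = {\<omega> \<in> A. X (Suc i) \<omega> \<noteq> x}"
  have "A' = A - {\<omega> \<in> space M. X (Suc i) \<omega> = x}" using Asub by (auto simp: A'_def)
  then have A': "A' \<in> sets (past (Suc i))"
    using Suc.prems sets_past_mono[of i "Suc i"] event_x_past[of "Suc i" "Suc i"] by auto
  have "{i<..i + Suc m} = insert (Suc i) {Suc i<..Suc i + m}" by auto
  then have "{\<omega> \<in> A. \<forall>j\<in>{i<..i + Suc m}. X j \<omega> \<noteq> x} = {\<omega> \<in> A'. \<forall>j\<in>{Suc i<..Suc i + m}. X j \<omega> \<noteq> x}"
    by (auto simp: A'_def)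
  then have "emeasure M {\<omega> \<in> A. \<forall>j\<in>{i<..i + Suc m}. X j \<omega> \<noteq> x}
      = (\<integral>\<^sup>+\<omega>\<in>A'. avoid m (X (Suc i) \<omega>) \<partial>M)"
    using Suc.IH[OF A'] by simp
  also have "\<dots> = (\<integral>\<^sup>+\<omega>\<in>A. (indicator (space S - {x}) (X (Suc i) \<omega>) * avoid m (X (Suc i) \<omega>)) \<partial>M)"
    by (intro nn_integral_cong)
       (auto simp: A'_def indicator_def dest: measurable_space[OF measurable_X])
  also have "\<dots> = (\<integral>\<^sup>+\<omega>\<in>A. avoid (Suc m) (X i \<omega>) \<partial>M)"
    using one_step[OF Suc.prems, of "\<lambda>s. indicator (space S - {x}) s * avoid m s"] by simp
  finally show ?case .
qed

lemma avoid_from_x: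
  assumes A: "A \<in> sets (past i)" and Ax: "\<And>\<omega>. \<omega> \<in> A \<Longrightarrow> X i \<omega> = x"
  shows "emeasure M {\<omega> \<in> A. \<forall>j\<in>{i<..i+m}. X j \<omega> \<noteq> x} = avoid m x * emeasure M A"
proof -
  have "(\<integral>\<^sup>+\<omega>\<in>A. avoid m (X i \<omega>) \<partial>M) = (\<integral>\<^sup>+\<omega>. avoid m x * indicator A \<omega> \<partial>M)"
    by (intro nn_integral_cong) (auto simp: indicator_def Ax)
  then show ?thesis
    using avoid_for_steps[OF A, of m] sets_past_sets[OF A] by (simp add: nn_integral_cmult_indicator)
qed

definition escape :: real where
  "escape = prob {\<omega> \<in> space M. \<forall>j>0. X j \<omega> \<noteq> x}"

lemma prob_avoid_tendsto:
  assumes [measurable]: "A \<in> sets M"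
  shows "(\<lambda>m. prob {\<omega> \<in> A. \<forall>j\<in>{i<..i+m}. X j \<omega> \<noteq> x}) \<longlonglongrightarrow> prob {\<omega> \<in> A. \<forall>j>i. X j \<omega> \<noteq> x}"
proof -
  have Asub: "A \<subseteq> space M" using sets.sets_into_space[OF assms] .
  have eq: "{\<omega> \<in> A. P \<omega>} = A \<inter> {\<omega> \<in> space M. P \<omega>}" for P using Asub by auto
  have "(\<Inter>m. {\<omega> \<in> A. \<forall>j\<in>{i<..i+m}. X j \<omega> \<noteq> x}) = {\<omega> \<in> A. \<forall>j>i. X j \<omega> \<noteq> x}"
  proof (intro equalityI subsetI)
    fix \<omega> assume *: "\<omega> \<in> (\<Inter>m. {\<omega> \<in> A. \<forall>j\<in>{i<..i+m}. X j \<omega> \<noteq> x})"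
    have "X j \<omega> \<noteq> x" if "j > i" for j
      using INT_D[OF *, of "j - i"] that by simp
    then show "\<omega> \<in> {\<omega> \<in> A. \<forall>j>i. X j \<omega> \<noteq> x}" using * by simp
  qed simp
  moreover have "(\<lambda>m. prob {\<omega> \<in> A. \<forall>j\<in>{i<..i+m}. X j \<omega> \<noteq> x})
      \<longlonglongrightarrow> prob (\<Inter>m. {\<omega> \<in> A. \<forall>j\<in>{i<..i+m}. X j \<omega> \<noteq> x})"
  proof (rule finite_Lim_measure_decseq)
    show "range (\<lambda>m. {\<omega> \<in> A. \<forall>j\<in>{i<..i+m}. X j \<omega> \<noteq> x}) \<subseteq> events"
      unfolding eq by (intro image_subsetI sets.Int assms) measurable
  qed (auto simp: decseq_def)
  ultimately show ?thesis by simp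
qed

lemma AE_start_restrict:
  assumes "Measurable.pred M P"
  shows "prob {\<omega> \<in> {\<omega> \<in> space M. X 0 \<omega> = x}. P \<omega>} = prob {\<omega> \<in> space M. P \<omega>}"
proof (rule finite_measure_eq_AE)
  show "AE \<omega> in M. \<omega> \<in> {\<omega> \<in> {\<omega> \<in> space M. X 0 \<omega> = x}. P \<omega>} \<longleftrightarrow> \<omega> \<in> {\<omega> \<in> space M. P \<omega>}"
    using start by eventually_elim auto
qed (use assms in measurable)

text \<open>
  Identifies the kernel quantity with a probability for the given chain, whose start is \<open>x\<close>; this
  lets the behaviour after any visit be compared with the behaviour after time \<open>0\<close>.
\<close>

lemma avoid_eq_prob: "avoid m x = prob {\<omega> \<in> space M. \<forall>j\<in>{0<..m}. X j \<omega> \<noteq> x}"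
proof -
  have 1: "prob {\<omega> \<in> space M. X 0 \<omega> = x} = 1"
    using start by (subst prob_Collect_eq_1) auto
  show ?thesis
    using avoid_from_x[OF event_x_past[of 0 0], of m] AE_start_restrict[of "\<lambda>\<omega>. \<forall>j\<in>{0<..m}. X j \<omega> \<noteq> x"] 1
    by (simp add: emeasure_eq_measure)
qed

text \<open>
  At every visit the chain starts afresh: the past is independent of whether the chain returns. Over a
  finite horizon both sides are given by \<open>avoid\<close>; the horizon then goes to infinity.
\<close>

lemma no_return_after:
  assumes A: "A \<in> sets (past i)" and Ax: "\<And>\<omega>. \<omega> \<in> A \<Longrightarrow> X i \<omega> = x"
  shows "prob {\<omega> \<in> A. \<forall>j>i. X j \<omega> \<noteq> x} = escape * prob A"
proof (rule LIMSEQ_unique)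
  show "(\<lambda>m. prob {\<omega> \<in> A. \<forall>j\<in>{i<..i+m}. X j \<omega> \<noteq> x}) \<longlonglongrightarrow> prob {\<omega> \<in> A. \<forall>j>i. X j \<omega> \<noteq> x}"
    by (rule prob_avoid_tendsto[OF sets_past_sets[OF A]])
  have "prob {\<omega> \<in> A. \<forall>j\<in>{i<..i+m}. X j \<omega> \<noteq> x}
      = prob {\<omega> \<in> space M. \<forall>j\<in>{0<..0+m}. X j \<omega> \<noteq> x} * prob A" for m
    using avoid_from_x[OF assms, of m]
    by (simp add: emeasure_eq_measure avoid_eq_prob ennreal_mult'[symmetric])
  then show "(\<lambda>m. prob {\<omega> \<in> A. \<forall>j\<in>{i<..i+m}. X j \<omega> \<noteq> x}) \<longlonglongrightarrow> escape * prob A"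
    using tendsto_mult_right[OF prob_avoid_tendsto[OF sets.top, of 0], of "prob A"]
    by (simp add: escape_def)
qed

lemma visits_eq_0_tendsto: "(\<lambda>n. prob {\<omega> \<in> space M. visits X x n \<omega> = 0}) \<longlonglongrightarrow> escape"
proof -
  have "visits X x n \<omega> = 0 \<longleftrightarrow> (\<forall>j\<in>{0<..0+n}. X j \<omega> \<noteq> x)" for n \<omega>
    by (auto simp: visits_def Suc_le_eq)
  then show ?thesis
    using prob_avoid_tendsto[OF sets.top, of 0] by (simp add: escape_def)
qed

lemma escape_eq_no_return: "escape = 1 - return_prob M X x"
proof -
  have "space M - {\<omega> \<in> space M. \<exists>i\<ge>1. X i \<omega> = x} = {\<omega> \<in> space M. \<forall>j>0. X j \<omega> \<noteq> x}"
    by (auto simp: Suc_le_eq)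
  moreover have "{\<omega> \<in> space M. \<exists>i\<ge>1. X i \<omega> = x} \<in> events" by measurable
  ultimately show ?thesis
    unfolding escape_def return_prob_def by (simp add: prob_compl flip: \<open>space M - _ = _\<close>)
qed

end

section \<open>Counting visits along a path\<close>

lemma visits_0 [simp]: "visits X x 0 \<omega> = 0"
  by (simp add: visits_def)

lemma visits_Suc: "visits X x (Suc n) \<omega> = visits X x n \<omega> + (if X (Suc n) \<omega> = x then 1 else 0)"
proof -
  have "{i \<in> {1..Suc n}. X i \<omega> = x}
      = (if X (Suc n) \<omega> = x then insert (Suc n) {i \<in> {1..n}. X i \<omega> = x} else {i \<in> {1..n}. X i \<omega> = x})"
    by (auto simp: le_Suc_eq)
  then show ?thesis by (simp add: visits_def)
qed

lemma visits_mono: "m \<le> n \<Longrightarrow> visits X x m \<omega> \<le> visits X x n \<omega>"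
  by (rule lift_Suc_mono_le[of "\<lambda>n. visits X x n \<omega>"]) (simp_all add: visits_Suc)

lemma visits_less_of_visit:
  assumes "i < j" "X j \<omega> = x"
  shows "visits X x i \<omega> < visits X x j \<omega>"
proof -
  obtain k where "j = Suc k" using assms(1) by (cases j) auto
  with assms visits_mono[of i k X x \<omega>] show ?thesis by (simp add: visits_Suc)
qed

text \<open>
  The count of visits grows by steps of at most one, so the first time at which it reaches \<open>k\<close> is a
  visit and the count is then exactly \<open>k\<close>. Time \<open>0\<close> takes this role for \<open>k = 0\<close>, hence the first
  assumption.
\<close>

lemma visit_number_attained:
  assumes "X 0 \<omega> = x" "k \<le> visits X x n \<omega>"
  shows "\<exists>i. X i \<omega> = x \<and> visits X x i \<omega> = k"
proof -
  define i where "i = (LEAST i. k \<le> visits X x i \<omega>)"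
  have i: "k \<le> visits X x i \<omega>" unfolding i_def by (rule LeastI) (rule assms(2))
  show ?thesis
  proof (cases i)
    case 0
    with i assms show ?thesis by (intro exI[of _ 0]) simp
  next
    case (Suc j)
    then have "\<not> k \<le> visits X x j \<omega>" using not_less_Least[of j "\<lambda>i. k \<le> visits X x i \<omega>"] by (simp add: i_def)
    with i Suc show ?thesis
      by (intro exI[of _ i]) (simp add: visits_Suc split: if_splits)
  qed
qed

lemma last_visit:
  fixes X :: "nat \<Rightarrow> 'w \<Rightarrow> 's"
  assumes "finite {i. X i \<omega> = x}" "X n \<omega> = x"
  shows "\<exists>i\<ge>n. X i \<omega> = x \<and> (\<forall>j>i. X j \<omega> \<noteq> x)"
proof -
  let ?m = "Max {i. X i \<omega> = x}"
  have n: "n \<in> {i. X i \<omega> = x}" using assms(2) by (rule CollectI)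
  have "n \<le> ?m" using assms(1) n by (rule Max_ge)
  moreover have "?m \<in> {i. X i \<omega> = x}"
    using assms(1) by (rule Max_in) (use n in blast)
  moreover have "X j \<omega> \<noteq> x" if "?m < j" for j
    using Max_ge[OF assms(1), of j] that by auto
  ultimately show ?thesis by blast
qed

text \<open>
  Where there are infinitely many visits the value is \<open>0\<close>, the cardinality given to infinite sets;
  for a transient state this is a null event by \<open>AE_finite_visits\<close>.
\<close>

definition total_visits :: "(nat \<Rightarrow> 'w \<Rightarrow> 's) \<Rightarrow> 's \<Rightarrow> 'w \<Rightarrow> nat" where
  "total_visits X x \<omega> = card {i. 1 \<le> i \<and> X i \<omega> = x}"

lemma total_visits_eq:
  assumes "\<And>j. j > n \<Longrightarrow> X j \<omega> \<noteq> x"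
  shows "total_visits X x \<omega> = visits X x n \<omega>"
proof -
  have "i \<le> n" if "X i \<omega> = x" for i
  proof (rule ccontr)
    assume "\<not> i \<le> n"
    with assms[of i] that show False by simp
  qed
  then have "{i. 1 \<le> i \<and> X i \<omega> = x} = {i \<in> {1..n}. X i \<omega> = x}"
    by auto
  then show ?thesis by (simp add: total_visits_def visits_def)
qed

section \<open>The last visit of a transient state\<close>

locale transient_chain = chain_from +
  assumes transient: "return_prob M X x < 1"
begin

lemma escape_pos: "0 < escape"
  using transient by (simp add: escape_eq_no_return)

lemma escape_le_1: "escape \<le> 1"
  by (simp add: escape_def)

lemma measurable_visits [measurable]: "visits X x n \<in> measurable M (count_space UNIV)"
  unfolding visits_def[abs_def] by measurable

lemma measurable_total_visits [measurable]: "total_visits X x \<in> measurable M (count_space UNIV)"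
  unfolding total_visits_def[abs_def] by measurable

lemma visits_event_past: "{\<omega> \<in> space M. X i \<omega> = x \<and> visits X x i \<omega> = k} \<in> sets (past i)"
proof -
  have 1: "Measurable.pred (past i) (\<lambda>\<omega>. X j \<omega> = x)" if "j \<le> i" for j
    using event_x_past[OF that] by (simp add: pred_def)
  have "visits X x n \<in> measurable (past i) (count_space UNIV)" if "n \<le> i" for n
    using that
  proof (induction n)
    case 0
    have "visits X x 0 = (\<lambda>\<omega>. 0)" by (rule ext) simp
    then show ?case by (simp only: measurable_const space_count_space UNIV_I)
  next
    case (Suc n)
    note [measurable] = 1[OF Suc.prems]
    have [measurable]: "(\<lambda>\<omega>. visits X x n \<omega>) \<in> measurable (past i) (count_space UNIV)"
      using Suc by simp
    show ?case unfolding visits_Suc by measurable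
  qed
  from measurable_sets[OF this[OF le_refl], of "{k}"]
  have "{\<omega> \<in> space M. X i \<omega> = x} \<inter> (visits X x i -` {k} \<inter> space M) \<in> sets (past i)"
    using event_x_past[of i i] by simp
  also have "{\<omega> \<in> space M. X i \<omega> = x} \<inter> (visits X x i -` {k} \<inter> space M)
      = {\<omega> \<in> space M. X i \<omega> = x \<and> visits X x i \<omega> = k}"
    by auto
  finally show ?thesis .
qed

text \<open>
  The event in the union is that \<open>n + i\<close> is the time of the last visit; these are disjoint and
  \<open>no_return_after\<close> gives the probability of each. The convergence of the series is part of the claim
  and yields \<open>summable_prob_visit\<close>.
\<close>

lemma sums_last_visit:
  "(\<lambda>i. escape * prob {\<omega> \<in> space M. X (n + i) \<omega> = x}) sums
     prob (\<Union>i. {\<omega> \<in> space M. X (n + i) \<omega> = x \<and> (\<forall>j>n+i. X j \<omega> \<noteq> x)})"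
proof -
  define E where "E i = {\<omega> \<in> space M. X (n + i) \<omega> = x \<and> (\<forall>j>n+i. X j \<omega> \<noteq> x)}" for i
  have "prob (E i) = escape * prob {\<omega> \<in> space M. X (n + i) \<omega> = x}" for i
  proof -
    have "E i = {\<omega> \<in> {\<omega> \<in> space M. X (n + i) \<omega> = x}. \<forall>j>n+i. X j \<omega> \<noteq> x}"
      by (auto simp: E_def)
    then show ?thesis
      using no_return_after[OF event_x_past[OF order_refl, of "n + i"]] by (simp only: mem_Collect_eq)
  qed
  moreover have "(\<lambda>i. prob (E i)) sums prob (\<Union>i. E i)"
  proof (rule finite_measure_UNION)
    show "range E \<subseteq> events"
      unfolding E_def by (intro image_subsetI) measurable
    show "disjoint_family E"
      unfolding disjoint_family_on_def
    proof (intro ballI impI)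
      fix a b :: nat assume "a \<noteq> b"
      then have "n + a < n + b \<or> n + b < n + a" by auto
      then show "E a \<inter> E b = {}" unfolding E_def by blast
    qed
  qed
  ultimately show ?thesis by (simp only: E_def)
qed

lemma summable_prob_visit: "summable (\<lambda>i. prob {\<omega> \<in> space M. X i \<omega> = x})"
  using sums_summable[OF sums_last_visit[of 0]] escape_pos by simp

lemma AE_finite_visits: "AE \<omega> in M. finite {i. X i \<omega> = x}"
proof -
  have "AE \<omega> in M. eventually (\<lambda>i. \<omega> \<in> space M - {\<omega> \<in> space M. X i \<omega> = x}) sequentially"
    by (rule borel_cantelli_AE1) (auto simp: summable_prob_visit less_top[symmetric])
  then show ?thesis
  proof eventually_elim
    case (elim \<omega>)
    then obtain n where "\<And>i. i \<ge> n \<Longrightarrow> X i \<omega> \<noteq> x" by (auto simp: eventually_sequentially)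
    then have "{i. X i \<omega> = x} \<subseteq> {..<n}" using not_less by blast
    then show ?case by (rule finite_subset) simp
  qed
qed

text \<open>
  If a visit occurs from time \<open>n\<close> on then, almost surely, the last visit also does.
\<close>

lemma prob_visit_after:
  "prob {\<omega> \<in> space M. \<exists>i\<ge>n. X i \<omega> = x} = escape * (\<Sum>i. prob {\<omega> \<in> space M. X (n + i) \<omega> = x})"
proof -
  have "prob {\<omega> \<in> space M. \<exists>i\<ge>n. X i \<omega> = x}
      = prob (\<Union>i. {\<omega> \<in> space M. X (n + i) \<omega> = x \<and> (\<forall>j>n+i. X j \<omega> \<noteq> x)})"
  proof (rule finite_measure_eq_AE)
    show "AE \<omega> in M. \<omega> \<in> {\<omega> \<in> space M. \<exists>i\<ge>n. X i \<omega> = x} \<longleftrightarrow>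
        \<omega> \<in> (\<Union>i. {\<omega> \<in> space M. X (n + i) \<omega> = x \<and> (\<forall>j>n+i. X j \<omega> \<noteq> x)})"
      using AE_finite_visits
    proof eventually_elim
      case (elim \<omega>)
      have "\<exists>k. X (n + k) \<omega> = x \<and> (\<forall>j>n+k. X j \<omega> \<noteq> x)" if i: "i \<ge> n" "X i \<omega> = x" for i
      proof -
        obtain l where "l \<ge> i" "X l \<omega> = x" "\<forall>j>l. X j \<omega> \<noteq> x"
          using last_visit[of X \<omega> x i] elim i(2) by auto
        with i(1) show ?thesis by (intro exI[of _ "l - n"]) simp
      qed
      moreover have "n \<le> n + i" for i by simp
      ultimately show ?case by blast
    qed
  qed measurable
  also have "\<dots> = (\<Sum>i. escape * prob {\<omega> \<in> space M. X (n + i) \<omega> = x})"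
    using sums_last_visit[of n] by (simp add: sums_iff)
  also have "\<dots> = escape * (\<Sum>i. prob {\<omega> \<in> space M. X (n + i) \<omega> = x})"
    using summable_prob_visit summable_ignore_initial_segment[OF summable_prob_visit, of n]
    by (intro suminf_mult) (simp add: add.commute)
  finally show ?thesis .
qed

section \<open>The total number of visits is geometric\<close>

text \<open>
  \<open>D i\<close> says that the \<open>k\<close>-th visit is at time \<open>i\<close> (the start counting as visit number \<open>0\<close>), and
  \<open>L i\<close> that it is moreover the last one. Each family is disjoint; up to null events the \<open>D i\<close> make up
  \<open>{k \<le> N}\<close> and the \<open>L i\<close> make up \<open>{N = k}\<close> for the total number of visits \<open>N\<close>. Each \<open>L i\<close> has
  \<open>escape\<close> times the probability of \<open>D i\<close>.
\<close>

lemma prob_total_visits_eq: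
  "prob {\<omega> \<in> space M. total_visits X x \<omega> = k} = escape * prob {\<omega> \<in> space M. k \<le> total_visits X x \<omega>}"
proof -
  define D where "D i = {\<omega> \<in> space M. X i \<omega> = x \<and> visits X x i \<omega> = k}" for i
  define L where "L i = {\<omega> \<in> D i. \<forall>j>i. X j \<omega> \<noteq> x}" for i
  have D: "D i \<in> sets M" for i unfolding D_def by measurable
  have L': "L i = {\<omega> \<in> space M. X i \<omega> = x \<and> visits X x i \<omega> = k \<and> (\<forall>j>i. X j \<omega> \<noteq> x)}" for i
    by (auto simp: L_def D_def)
  have L: "L i \<in> sets M" for i unfolding L' by measurable
  have disj: "disjoint_family D"
    unfolding disjoint_family_on_def
  proof (intro ballI impI)
    fix a b :: nat assume "a \<noteq> b"
    moreover have "visits X x i \<omega> < visits X x j \<omega>" if "i < j" "\<omega> \<in> D j" for i j \<omega>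
      using that by (intro visits_less_of_visit) (simp_all add: D_def)
    ultimately show "D a \<inter> D b = {}"
      by (cases a b rule: linorder_cases) (fastforce simp: D_def)+
  qed
  have sumsD: "(\<lambda>i. prob (D i)) sums prob (\<Union>i. D i)"
    using D disj by (intro finite_measure_UNION) auto
  have "disjoint_family L"
    by (rule disjoint_family_subset[OF disj]) (simp add: L_def)
  then have sumsL: "(\<lambda>i. prob (L i)) sums prob (\<Union>i. L i)"
    using L by (intro finite_measure_UNION) auto
  have "prob (L i) = escape * prob (D i)" for i
    unfolding L_def
  proof (rule no_return_after)
    show "D i \<in> sets (past i)" unfolding D_def by (rule visits_event_past)
    show "\<And>\<omega>. \<omega> \<in> D i \<Longrightarrow> X i \<omega> = x" by (simp add: D_def)
  qed
  then have *: "prob (\<Union>i. L i) = escape * prob (\<Union>i. D i)"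
    using sums_unique2[OF sumsL] sums_mult[OF sumsD, of escape] by (simp only:)
  have AE: "AE \<omega> in M. finite {i. X i \<omega> = x} \<and> X 0 \<omega> = x \<and> \<omega> \<in> space M"
    using AE_finite_visits start AE_space by eventually_elim auto
  have "prob {\<omega> \<in> space M. total_visits X x \<omega> = k} = prob (\<Union>i. L i)"
  proof (rule finite_measure_eq_AE)
    show "AE \<omega> in M. \<omega> \<in> {\<omega> \<in> space M. total_visits X x \<omega> = k} \<longleftrightarrow> \<omega> \<in> (\<Union>i. L i)"
      using AE
    proof eventually_elim
      case (elim \<omega>)
      then obtain l where l: "X l \<omega> = x" "\<forall>j>l. X j \<omega> \<noteq> x" using last_visit[of X \<omega> x 0] by auto
      have "\<omega> \<in> L l" if "total_visits X x \<omega> = k"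
        using l elim that total_visits_eq[of l X \<omega> x] by (simp add: L')
      moreover have "total_visits X x \<omega> = k" if "\<omega> \<in> L i" for i
        using that total_visits_eq[of i X \<omega> x] by (simp add: L')
      ultimately show ?case using elim by blast
    qed
  qed (use L in auto)
  moreover have "prob {\<omega> \<in> space M. k \<le> total_visits X x \<omega>} = prob (\<Union>i. D i)"
  proof (rule finite_measure_eq_AE)
    show "AE \<omega> in M. \<omega> \<in> {\<omega> \<in> space M. k \<le> total_visits X x \<omega>} \<longleftrightarrow> \<omega> \<in> (\<Union>i. D i)"
      using AE
    proof eventually_elim
      case (elim \<omega>)
      then obtain l where l: "X l \<omega> = x" "\<forall>j>l. X j \<omega> \<noteq> x" using last_visit[of X \<omega> x 0] by auto
      then have t: "total_visits X x \<omega> = visits X x l \<omega>" by (simp add: total_visits_eq)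
      have "visits X x i \<omega> \<le> visits X x l \<omega>" if "X i \<omega> = x" for i
        using l(2) that not_less by (intro visits_mono) blast
      then show ?case
        using elim visit_number_attained[of X \<omega> x k l] by (auto simp: D_def t)
    qed
  qed (use D in auto)
  ultimately show ?thesis using * by simp
qed

lemma prob_total_visits_ge: "prob {\<omega> \<in> space M. k \<le> total_visits X x \<omega>} = (1 - escape) ^ k"
proof (induction k)
  case 0
  then show ?case by (simp add: prob_space)
next
  case (Suc k)
  have "prob {\<omega> \<in> space M. k \<le> total_visits X x \<omega>}
      = prob ({\<omega> \<in> space M. total_visits X x \<omega> = k} \<union> {\<omega> \<in> space M. Suc k \<le> total_visits X x \<omega>})"
    by (rule arg_cong[where f=prob]) auto
  also have "\<dots> = prob {\<omega> \<in> space M. total_visits X x \<omega> = k}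
      + prob {\<omega> \<in> space M. Suc k \<le> total_visits X x \<omega>}"
    by (rule finite_measure_Union) auto
  finally show ?case
    using Suc prob_total_visits_eq[of k] by (simp add: algebra_simps)
qed

lemma distr_total_visits:
  "distr M (count_space UNIV) (total_visits X x) = measure_pmf (geometric_pmf escape)"
proof (rule measure_eqI_countable[where A=UNIV])
  fix k :: nat
  have "emeasure (distr M (count_space UNIV) (total_visits X x)) {k}
      = prob {\<omega> \<in> space M. total_visits X x \<omega> = k}"
    by (subst emeasure_distr)
       (auto simp: emeasure_eq_measure vimage_def Int_def conj_commute)
  also have "\<dots> = ennreal (escape * (1 - escape) ^ k)"
    by (simp only: prob_total_visits_eq prob_total_visits_ge)
  finally show "emeasure (distr M (count_space UNIV) (total_visits X x)) {k}
      = emeasure (measure_pmf (geometric_pmf escape)) {k}"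
    using escape_pos escape_le_1 by (simp add: emeasure_pmf_single mult.commute)
qed auto

section \<open>Total variation bound by coupling\<close>

text \<open>
  The two counts are defined on the same space and agree unless a visit occurs after time \<open>n\<close>.
\<close>

lemma visits_total_visits_distance:
  "\<bar>prob {\<omega> \<in> space M. visits X x n \<omega> \<in> A} - prob {\<omega> \<in> space M. total_visits X x \<omega> \<in> A}\<bar>
    \<le> prob {\<omega> \<in> space M. \<exists>i\<ge>n+1. X i \<omega> = x}"
proof -
  let ?V = "{\<omega> \<in> space M. visits X x n \<omega> \<in> A}"
  let ?T = "{\<omega> \<in> space M. total_visits X x \<omega> \<in> A}"
  let ?R = "{\<omega> \<in> space M. \<exists>i\<ge>n+1. X i \<omega> = x}"
  have meas: "?V \<in> events" "?T \<in> events" "?R \<in> events" by measurable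
  have eq: "total_visits X x \<omega> = visits X x n \<omega>" if "\<omega> \<in> space M" "\<omega> \<notin> ?R" for \<omega>
    using that by (intro total_visits_eq) (auto simp: Suc_le_eq)
  have "prob ?V \<le> prob ?T + prob ?R"
    by (rule order_trans[OF finite_measure_mono[of _ "?T \<union> ?R"] measure_Un_le])
       (use meas eq in auto)
  moreover have "prob ?T \<le> prob ?V + prob ?R"
    by (rule order_trans[OF finite_measure_mono[of _ "?V \<union> ?R"] measure_Un_le])
       (use meas eq in auto)
  ultimately show ?thesis by linarith
qed

lemma tv_dist_visits_le:
  assumes "H \<in> measurable M' (count_space UNIV)"
    and "distr M' (count_space UNIV) H = measure_pmf (geometric_pmf escape)"
  shows "tv_dist M (visits X x n) M' H \<le> prob {\<omega> \<in> space M. \<exists>i\<ge>n+1. X i \<omega> = x}"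
  unfolding tv_dist_def
proof (rule cSUP_least)
  fix A :: "nat set"
  have "measure M' {\<omega> \<in> space M'. H \<omega> \<in> A} = measure (distr M' (count_space UNIV) H) A"
    using assms(1) by (subst measure_distr) (auto simp: vimage_def Int_def conj_commute)
  also have "\<dots> = measure (distr M (count_space UNIV) (total_visits X x)) A"
    by (simp add: assms(2) distr_total_visits)
  also have "\<dots> = prob {\<omega> \<in> space M. total_visits X x \<omega> \<in> A}"
    by (subst measure_distr) (auto simp: vimage_def Int_def conj_commute)
  finally show "\<bar>prob {\<omega> \<in> space M. visits X x n \<omega> \<in> A} - measure M' {\<omega> \<in> space M'. H \<omega> \<in> A}\<bar>
      \<le> prob {\<omega> \<in> space M. \<exists>i\<ge>n+1. X i \<omega> = x}"
    using visits_total_visits_distance by simp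
qed simp

end

theorem theorem1:
  fixes M :: "'w measure" and S :: "'s measure" and K :: "'s \<Rightarrow> 's measure"
    and X :: "nat \<Rightarrow> 'w \<Rightarrow> 's" and x :: 's
    and M' :: "'h measure" and H :: "'h \<Rightarrow> nat" and q :: real
  assumes "markov_chain M S K X"
    and "{x} \<in> sets S"
    and "AE \<omega> in M. X 0 \<omega> = x"
    and "return_prob M X x < 1"
    and "q = lim (\<lambda>n. measure M {\<omega> \<in> space M. visits X x n \<omega> = 0})"
    and "prob_space M'"
    and "H \<in> measurable M' (count_space UNIV)"
    and "distr M' (count_space UNIV) H = measure_pmf (geometric_pmf q)"
  shows "convergent (\<lambda>n. measure M {\<omega> \<in> space M. visits X x n \<omega> = 0}) \<and>
    0 < q \<and>
    summable (\<lambda>i. measure M {\<omega> \<in> space M. X i \<omega> = x}) \<and>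
    (\<forall>n\<ge>1. tv_dist M (visits X x n) M' H
       \<le> q * real_of_int \<lceil>(1 - q) / q\<rceil> *
          (\<Sum>i. measure M {\<omega> \<in> space M. X (n + 1 + i) \<omega> = x}))"
proof -
  interpret markov_chain M S K X by fact
  interpret transient_chain M S K X x by unfold_locales fact+
  have q: "q = escape"
    using visits_eq_0_tendsto by (simp add: assms(5) limI)
  have "tv_dist M (visits X x n) M' H
      \<le> q * real_of_int \<lceil>(1 - q) / q\<rceil> * (\<Sum>i. prob {\<omega> \<in> space M. X (n + 1 + i) \<omega> = x})" for n
  proof -
    let ?R = "{\<omega> \<in> space M. \<exists>i\<ge>n+1. X i \<omega> = x}"
    have "tv_dist M (visits X x n) M' H \<le> prob ?R"
      using assms(7,8) q by (intro tv_dist_visits_le) auto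
    also have "\<dots> \<le> real_of_int \<lceil>(1 - q) / q\<rceil> * prob ?R"
    proof (cases "q = 1")
      case True
      \<comment> \<open>The ceiling is \<open>0\<close> here, so the event of a later visit must itself be null.\<close>
      have "prob ?R \<le> return_prob M X x"
        unfolding return_prob_def
      proof (rule finite_measure_mono)
        have "1 \<le> i" if "n + 1 \<le> i" for i using that by simp
        then show "?R \<subseteq> {\<omega> \<in> space M. \<exists>i\<ge>1. X i \<omega> = x}" by blast
      qed measurable
      then show ?thesis using True q escape_eq_no_return by simp
    next
      case False
      then have "0 < (1 - q) / q" using escape_pos escape_le_1 q by simp
      then have "1 \<le> \<lceil>(1 - q) / q\<rceil>" by linarith
      then show ?thesis by (simp add: mult_le_cancel_right1)
    qed
    also have "\<dots> = q * real_of_int \<lceil>(1 - q) / q\<rceil> * (\<Sum>i. prob {\<omega> \<in> space M. X (n + 1 + i) \<omega> = x})"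
      by (simp only: prob_visit_after q mult_ac)
    finally show ?thesis .
  qed
  then show ?thesis
    using visits_eq_0_tendsto escape_pos summable_prob_visit q by (auto simp: convergent_def)
qed

end
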